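(* Let $(C,\Delta,\gamma,\alpha)$ be a post-Hom-Lie coalgebra (with Hom-Lie cobracket $\gamma$). Then $C$, with the map $\tilde\Delta=\Delta+\frac12\gamma$, is an admissible Hom-Lie coalgebra; that is, $\tilde\gamma=(1-\tau)\circ\tilde\Delta$ satisfies the Hom-co-Jacobi identity $(1+\xi+\xi^2)\circ(\alpha\otimes\tilde\gamma)\circ\tilde\gamma=0$.
   Context: All vector spaces are over a field $\mathbb{F}$ of characteristic $0$; $I$ is the identity map, $\tau(x\otimes y)=y\otimes x$, $\xi(x\otimes y\otimes z)=y\otimes z\otimes x$, $\xi^2(x\otimes y\otimes z)=z\otimes x\otimes y$. A post-Hom-Lie coalgebra is a vector space $C$ with linear maps $\Delta,\gamma:C\to C\otimes C$ and $\alpha:C\to C$ such that (i) $\gamma=-\tau\circ\gamma$ and $\gamma\circ\alpha=(\alpha\otimes\alpha)\circ\gamma$; (ii) $(1+\xi+\xi^2)\circ(\alpha\otimes\gamma)\circ\gamma=0$; (iii) $(\alpha\otimes\gamma)\circ\Delta-(\Delta\otimes\alpha)\circ\gamma-(\tau\otimes I)\circ(\alpha\otimes\Delta)\circ\gamma=0$; (iv) $(\Delta\otimes\alpha)\circ\Delta-(\alpha\otimes\Delta)\circ\Delta-(\tau\otimes I)\circ(\Delta\otimes\alpha)\circ\Delta+(\tau\otimes I)\circ(\alpha\otimes\Delta)\circ\Delta+(\gamma\otimes\alpha)\circ\Delta=0$. *)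

theory Defs
  imports "HOL-Algebra.AbelCoset" "Jordan_Normal_Form.Missing_VectorSpace"
begin

section \<open>Tensor products of modules\<close>

definition free_module :: "('k, 'm) ring_scheme \<Rightarrow> 's set \<Rightarrow> ('k, 's \<Rightarrow> 'k) module" where
  "free_module K S = (ring.func_space K S)
     \<lparr>carrier := {f \<in> S \<rightarrow>\<^sub>E carrier K. finite {s \<in> S. f s \<noteq> \<zero>\<^bsub>K\<^esub>}}\<rparr>"

definition free_gen :: "('k, 'm) ring_scheme \<Rightarrow> 's set \<Rightarrow> 's \<Rightarrow> 's \<Rightarrow> 'k" where
  "free_gen K S s = (\<lambda>t\<in>S. if t = s then \<one>\<^bsub>K\<^esub> else \<zero>\<^bsub>K\<^esub>)"

text \<open>The fields \<^const>\<open>mult\<close> and \<^const>\<open>one\<close> of a module record carry no meaning.\<close>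

definition quotient_module :: "('k, 'v, 'n) module_scheme \<Rightarrow> 'v set \<Rightarrow> ('k, 'v set) module" where
  "quotient_module V N =
     \<lparr>carrier = a_rcosets\<^bsub>V\<^esub> N,
      mult = (\<lambda>X Y. N),
      one = N,
      zero = N,
      add = (\<lambda>X Y. X <+>\<^bsub>V\<^esub> Y),
      smult = (\<lambda>a X. \<Union>x\<in>X. N +>\<^bsub>V\<^esub> (a \<odot>\<^bsub>V\<^esub> x))\<rparr>"

definition tensor_relators ::
  "('k, 'm) ring_scheme \<Rightarrow> ('k, 'u, 'n1) module_scheme \<Rightarrow> ('k, 'v, 'n2) module_scheme
    \<Rightarrow> ('u \<times> 'v \<Rightarrow> 'k) set" where
  "tensor_relators K U V =
    (let F = free_module K (carrier U \<times> carrier V);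
         e = (\<lambda>u v. free_gen K (carrier U \<times> carrier V) (u, v))
     in {e (u \<oplus>\<^bsub>U\<^esub> u') v \<ominus>\<^bsub>F\<^esub> (e u v \<oplus>\<^bsub>F\<^esub> e u' v) | u u' v.
           u \<in> carrier U \<and> u' \<in> carrier U \<and> v \<in> carrier V}
      \<union> {e u (v \<oplus>\<^bsub>V\<^esub> v') \<ominus>\<^bsub>F\<^esub> (e u v \<oplus>\<^bsub>F\<^esub> e u v') | u v v'.
           u \<in> carrier U \<and> v \<in> carrier V \<and> v' \<in> carrier V}
      \<union> {e (a \<odot>\<^bsub>U\<^esub> u) v \<ominus>\<^bsub>F\<^esub> (a \<odot>\<^bsub>F\<^esub> e u v) | a u v.
           a \<in> carrier K \<and> u \<in> carrier U \<and> v \<in> carrier V}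
      \<union> {e u (a \<odot>\<^bsub>V\<^esub> v) \<ominus>\<^bsub>F\<^esub> (a \<odot>\<^bsub>F\<^esub> e u v) | a u v.
           a \<in> carrier K \<and> u \<in> carrier U \<and> v \<in> carrier V})"

definition tensor_kernel ::
  "('k, 'm) ring_scheme \<Rightarrow> ('k, 'u, 'n1) module_scheme \<Rightarrow> ('k, 'v, 'n2) module_scheme
    \<Rightarrow> ('u \<times> 'v \<Rightarrow> 'k) set" where
  "tensor_kernel K U V =
     module.span K (free_module K (carrier U \<times> carrier V)) (tensor_relators K U V)"

definition tensor ::
  "('k, 'm) ring_scheme \<Rightarrow> ('k, 'u, 'n1) module_scheme \<Rightarrow> ('k, 'v, 'n2) module_scheme
    \<Rightarrow> ('k, ('u \<times> 'v \<Rightarrow> 'k) set) module" where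
  "tensor K U V =
     quotient_module (free_module K (carrier U \<times> carrier V)) (tensor_kernel K U V)"

definition pure_tensor ::
  "('k, 'm) ring_scheme \<Rightarrow> ('k, 'u, 'n1) module_scheme \<Rightarrow> ('k, 'v, 'n2) module_scheme
    \<Rightarrow> 'u \<Rightarrow> 'v \<Rightarrow> ('u \<times> 'v \<Rightarrow> 'k) set" where
  "pure_tensor K U V u v =
     tensor_kernel K U V +>\<^bsub>free_module K (carrier U \<times> carrier V)\<^esub>
       free_gen K (carrier U \<times> carrier V) (u, v)"

definition bilinear_map ::
  "('k, 'm) ring_scheme \<Rightarrow> ('k, 'u, 'n1) module_scheme \<Rightarrow> ('k, 'v, 'n2) module_scheme
    \<Rightarrow> ('k, 'w, 'n3) module_scheme \<Rightarrow> ('u \<Rightarrow> 'v \<Rightarrow> 'w) \<Rightarrow> bool" where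
  "bilinear_map K U V W b \<longleftrightarrow>
     (\<forall>u\<in>carrier U. b u \<in> module_hom K V W) \<and>
     (\<forall>v\<in>carrier V. (\<lambda>u. b u v) \<in> module_hom K U W)"

text \<open>The linear map on \<^term>\<open>tensor K U V\<close> given on pure tensors by \<^term>\<open>b\<close>; for bilinear
  \<^term>\<open>b\<close> it exists and is unique, see \<open>tensor_universal\<close> below.\<close>

definition tensor_lift ::
  "('k, 'm) ring_scheme \<Rightarrow> ('k, 'u, 'n1) module_scheme \<Rightarrow> ('k, 'v, 'n2) module_scheme
    \<Rightarrow> ('k, 'w, 'n3) module_scheme \<Rightarrow> ('u \<Rightarrow> 'v \<Rightarrow> 'w) \<Rightarrow> ('u \<times> 'v \<Rightarrow> 'k) set \<Rightarrow> 'w" where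
  "tensor_lift K U V W b =
     (THE h. h \<in> module_hom K (tensor K U V) W \<and> h \<in> extensional (carrier (tensor K U V)) \<and>
        (\<forall>u\<in>carrier U. \<forall>v\<in>carrier V. h (pure_tensor K U V u v) = b u v))"

subsection \<open>The universal property\<close>

lemma free_submodule:
  assumes "cring K"
  shows "submodule K {f \<in> S \<rightarrow>\<^sub>E carrier K. finite {s \<in> S. f s \<noteq> \<zero>\<^bsub>K\<^esub>}} (ring.func_space K S)"
proof -
  interpret cring K by fact
  show ?thesis
  proof (rule submodule.intro, goal_cases)
    case 1 show ?case by (rule func_space_is_module)
  next
    case 2 show ?case by (auto simp: func_space_def)
  next
    case (3 v w)
    have "finite ({s \<in> S. v s \<noteq> \<zero>\<^bsub>K\<^esub>} \<union> {s \<in> S. w s \<noteq> \<zero>\<^bsub>K\<^esub>})" using 3 by auto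
    moreover have "{s \<in> S. v s \<oplus>\<^bsub>K\<^esub> w s \<noteq> \<zero>\<^bsub>K\<^esub>} \<subseteq> {s \<in> S. v s \<noteq> \<zero>\<^bsub>K\<^esub>} \<union> {s \<in> S. w s \<noteq> \<zero>\<^bsub>K\<^esub>}"
      by auto
    ultimately have "finite {s \<in> S. v s \<oplus>\<^bsub>K\<^esub> w s \<noteq> \<zero>\<^bsub>K\<^esub>}" by (rule finite_subset[rotated])
    moreover have "{s \<in> S. (v \<oplus>\<^bsub>func_space S\<^esub> w) s \<noteq> \<zero>\<^bsub>K\<^esub>} = {s \<in> S. v s \<oplus>\<^bsub>K\<^esub> w s \<noteq> \<zero>\<^bsub>K\<^esub>}"
      by (auto simp: func_space_def)
    ultimately show ?case using 3 by (auto simp: func_space_def PiE_mem)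
  next
    case 4 show ?case by (auto simp: func_space_def)
  next
    case (5 c v)
    have "{s \<in> S. (c \<odot>\<^bsub>func_space S\<^esub> v) s \<noteq> \<zero>\<^bsub>K\<^esub>} \<subseteq> {s \<in> S. v s \<noteq> \<zero>\<^bsub>K\<^esub>}"
      using 5 by (auto simp: func_space_def)
    then have "finite {s \<in> S. (c \<odot>\<^bsub>func_space S\<^esub> v) s \<noteq> \<zero>\<^bsub>K\<^esub>}"
      using 5 by (auto intro: finite_subset)
    then show ?case using 5 by (auto simp: func_space_def PiE_mem)
  qed
qed

lemma free_module_is_module:
  assumes "cring K"
  shows "module K (free_module K S)"
proof -
  interpret cring K by fact
  interpret F: module K "func_space S" by (rule func_space_is_module)
  show ?thesis unfolding free_module_def
    by (rule F.submodule_is_module[OF free_submodule[OF assms]])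
qed

lemma (in cring) free_simps:
  "carrier (free_module R S) = {f \<in> S \<rightarrow>\<^sub>E carrier R. finite {s \<in> S. f s \<noteq> \<zero>}}"
  "f \<oplus>\<^bsub>free_module R S\<^esub> g = (\<lambda>s\<in>S. f s \<oplus> g s)"
  "c \<odot>\<^bsub>free_module R S\<^esub> f = (\<lambda>s\<in>S. c \<otimes> f s)"
  "\<zero>\<^bsub>free_module R S\<^esub> = (\<lambda>s\<in>S. \<zero>)"
  by (simp_all add: free_module_def func_space_def)

lemma (in cring) free_gen_closed [simp]: "free_gen R S s \<in> carrier (free_module R S)"
proof -
  have "finite {t \<in> S. free_gen R S s t \<noteq> \<zero>}"
    by (rule finite_subset[of _ "{s}"]) (auto simp: free_gen_def)
  then show ?thesis by (auto simp: free_simps free_gen_def)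
qed

text \<open>Linear extension from the generators of a free module.\<close>

definition free_lift ::
  "('k, 'm) ring_scheme \<Rightarrow> 's set \<Rightarrow> ('k, 'w, 'n) module_scheme \<Rightarrow> ('s \<Rightarrow> 'w) \<Rightarrow> ('s \<Rightarrow> 'k) \<Rightarrow> 'w"
  where "free_lift K S W b f = (\<Oplus>\<^bsub>W\<^esub>s\<in>{s \<in> S. f s \<noteq> \<zero>\<^bsub>K\<^esub>}. f s \<odot>\<^bsub>W\<^esub> b s)"

lemma (in module) free_lift_superset:
  assumes "finite A" "A \<subseteq> S" "{s \<in> S. f s \<noteq> \<zero>} \<subseteq> A" "f \<in> S \<rightarrow> carrier R" "b \<in> S \<rightarrow> carrier M"
  shows "free_lift R S M b f = (\<Oplus>\<^bsub>M\<^esub>s\<in>A. f s \<odot>\<^bsub>M\<^esub> b s)"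
  unfolding free_lift_def
proof (rule M.add.finprod_mono_neutral_cong_left)
  show "\<And>i. i \<in> A - {s \<in> S. f s \<noteq> \<zero>} \<Longrightarrow> f i \<odot>\<^bsub>M\<^esub> b i = \<zero>\<^bsub>M\<^esub>"
    using assms by (auto simp: Pi_iff subset_iff)
qed (use assms in \<open>auto simp: Pi_iff subset_iff\<close>)

lemma (in module) free_lift_hom:
  assumes b: "b \<in> S \<rightarrow> carrier M"
  shows "free_lift R S M b \<in> module_hom R (free_module R S) M"
proof -
  have fin: "finite {s \<in> S. f s \<noteq> \<zero>}" "f \<in> S \<rightarrow> carrier R"
    if "f \<in> carrier (free_module R S)" for f using that by (auto simp: free_simps)
  show ?thesis unfolding module_hom_def
  proof (intro CollectI conjI allI impI funcsetI, goal_cases)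
    case (1 f)
    show ?case unfolding free_lift_def
      using fin[OF 1] b by (intro M.finsum_closed) (auto simp: Pi_iff)
  next
    case (2 f g)
    let ?A = "{s \<in> S. f s \<noteq> \<zero>} \<union> {s \<in> S. g s \<noteq> \<zero>}"
    have f: "f \<in> S \<rightarrow> carrier R" and g: "g \<in> S \<rightarrow> carrier R" using 2 fin by auto
    have A: "finite ?A" "?A \<subseteq> S" using 2 fin by auto
    have "free_lift R S M b (f \<oplus>\<^bsub>free_module R S\<^esub> g)
        = (\<Oplus>\<^bsub>M\<^esub>s\<in>?A. (f \<oplus>\<^bsub>free_module R S\<^esub> g) s \<odot>\<^bsub>M\<^esub> b s)"
      using f g b A by (intro free_lift_superset) (auto simp: free_simps Pi_iff)
    also have "\<dots> = (\<Oplus>\<^bsub>M\<^esub>s\<in>?A. f s \<odot>\<^bsub>M\<^esub> b s \<oplus>\<^bsub>M\<^esub> g s \<odot>\<^bsub>M\<^esub> b s)"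
      using f g b by (intro M.finsum_cong') (auto simp: free_simps Pi_iff smult_l_distr)
    also have "\<dots> = (\<Oplus>\<^bsub>M\<^esub>s\<in>?A. f s \<odot>\<^bsub>M\<^esub> b s) \<oplus>\<^bsub>M\<^esub> (\<Oplus>\<^bsub>M\<^esub>s\<in>?A. g s \<odot>\<^bsub>M\<^esub> b s)"
      using f g b by (intro M.finsum_addf) (auto simp: Pi_iff)
    also have "(\<Oplus>\<^bsub>M\<^esub>s\<in>?A. f s \<odot>\<^bsub>M\<^esub> b s) = free_lift R S M b f"
      using f b A by (intro free_lift_superset[symmetric]) auto
    also have "(\<Oplus>\<^bsub>M\<^esub>s\<in>?A. g s \<odot>\<^bsub>M\<^esub> b s) = free_lift R S M b g"
      using g b A by (intro free_lift_superset[symmetric]) auto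
    finally show ?case .
  next
    case (3 c f)
    let ?A = "{s \<in> S. f s \<noteq> \<zero>}"
    have f: "f \<in> S \<rightarrow> carrier R" and c: "c \<in> carrier R" and A: "finite ?A" using 3 fin by auto
    have "free_lift R S M b (c \<odot>\<^bsub>free_module R S\<^esub> f)
        = (\<Oplus>\<^bsub>M\<^esub>s\<in>?A. (c \<odot>\<^bsub>free_module R S\<^esub> f) s \<odot>\<^bsub>M\<^esub> b s)"
      using f c b A by (intro free_lift_superset) (auto simp: free_simps Pi_iff)
    also have "\<dots> = (\<Oplus>\<^bsub>M\<^esub>s\<in>?A. c \<odot>\<^bsub>M\<^esub> (f s \<odot>\<^bsub>M\<^esub> b s))"
      using f c b by (intro M.finsum_cong') (auto simp: free_simps Pi_iff smult_assoc1)
    also have "\<dots> = c \<odot>\<^bsub>M\<^esub> free_lift R S M b f"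
      unfolding free_lift_def using f c b by (intro finsum_smult[symmetric]) (auto simp: Pi_iff)
    finally show ?case .
  qed
qed

lemma (in module) free_lift_gen:
  assumes b: "b \<in> S \<rightarrow> carrier M" and s: "s \<in> S"
  shows "free_lift R S M b (free_gen R S s) = b s"
proof -
  have "free_lift R S M b (free_gen R S s) = (\<Oplus>\<^bsub>M\<^esub>t\<in>{s}. free_gen R S s t \<odot>\<^bsub>M\<^esub> b t)"
    using s b by (intro free_lift_superset) (auto simp: free_gen_def Pi_iff)
  also have "\<dots> = b s"
    using s b by (subst M.finsum_insert) (auto simp: free_gen_def Pi_iff)
  finally show ?thesis .
qed

lemma submodule_abelian_subgroup:
  assumes "submodule K N V"
  shows "abelian_subgroup N V"
proof -
  interpret submodule K N V by fact
  interpret V: module K V by (rule module)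
  show ?thesis
  proof (rule abelian_subgroupI3)
    show "additive_subgroup N V"
    proof (unfold_locales, goal_cases)
      case 1 show ?case using subset by simp
    next
      case (4 x)
      then have "\<ominus>\<^bsub>V\<^esub> x = (\<ominus>\<^bsub>K\<^esub> \<one>\<^bsub>K\<^esub>) \<odot>\<^bsub>V\<^esub> x" using subset V.smult_minus_1[of x] by auto
      also have "\<dots> \<in> N" using 4 by simp
      finally show ?case by (simp add: a_inv_def)
    qed auto
  qed unfold_locales
qed

lemma quotient_smult:
  assumes "submodule K N V" "a \<in> carrier K" "x \<in> carrier V"
  shows "a \<odot>\<^bsub>quotient_module V N\<^esub> (N +>\<^bsub>V\<^esub> x) = N +>\<^bsub>V\<^esub> (a \<odot>\<^bsub>V\<^esub> x)"
proof -
  interpret submodule K N V by fact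
  interpret V: module K V by (rule module)
  interpret N: abelian_subgroup N V by (rule submodule_abelian_subgroup) fact
  have "N +>\<^bsub>V\<^esub> (a \<odot>\<^bsub>V\<^esub> y) = N +>\<^bsub>V\<^esub> (a \<odot>\<^bsub>V\<^esub> x)" if y: "y \<in> N +>\<^bsub>V\<^esub> x" for y
  proof (rule N.a_repr_independence'[symmetric])
    obtain n where n: "n \<in> N" "y = n \<oplus>\<^bsub>V\<^esub> x" using y by (auto simp: a_r_coset_def')
    have "n \<in> carrier V" using n subset by blast
    then have "a \<odot>\<^bsub>V\<^esub> y = a \<odot>\<^bsub>V\<^esub> n \<oplus>\<^bsub>V\<^esub> a \<odot>\<^bsub>V\<^esub> x"
      unfolding n(2) using assms by (intro V.smult_r_distr)
    moreover have "a \<odot>\<^bsub>V\<^esub> n \<in> N" using n(1) assms(2) by (rule smult_closed[rotated])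
    ultimately show "a \<odot>\<^bsub>V\<^esub> y \<in> N +>\<^bsub>V\<^esub> (a \<odot>\<^bsub>V\<^esub> x)"
      unfolding a_r_coset_def' by blast
  qed (use assms in auto)
  then have "(\<Union>y\<in>N +>\<^bsub>V\<^esub> x. N +>\<^bsub>V\<^esub> (a \<odot>\<^bsub>V\<^esub> y)) = (\<Union>y\<in>N +>\<^bsub>V\<^esub> x. N +>\<^bsub>V\<^esub> (a \<odot>\<^bsub>V\<^esub> x))"
    by (rule SUP_cong[OF refl])
  also have "\<dots> = N +>\<^bsub>V\<^esub> (a \<odot>\<^bsub>V\<^esub> x)"
    using N.a_rcos_self[OF assms(3)] by (intro UN_constant_eq) auto
  finally show ?thesis by (simp add: quotient_module_def)
qed

lemma quotient_add:
  assumes "submodule K N V" "x \<in> carrier V" "y \<in> carrier V"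
  shows "(N +>\<^bsub>V\<^esub> x) \<oplus>\<^bsub>quotient_module V N\<^esub> (N +>\<^bsub>V\<^esub> y) = N +>\<^bsub>V\<^esub> (x \<oplus>\<^bsub>V\<^esub> y)"
proof -
  interpret N: abelian_subgroup N V by (rule submodule_abelian_subgroup) fact
  show ?thesis using assms by (simp add: quotient_module_def N.a_rcos_sum)
qed

lemma quotient_carrierE:
  assumes "X \<in> carrier (quotient_module V N)"
  obtains x where "x \<in> carrier V" "X = N +>\<^bsub>V\<^esub> x"
  using assms by (auto simp: quotient_module_def A_RCOSETS_def')

lemma quotient_carrierI:
  "x \<in> carrier V \<Longrightarrow> N +>\<^bsub>V\<^esub> x \<in> carrier (quotient_module V N)"
  by (auto simp: quotient_module_def A_RCOSETS_def')

lemma quotient_is_module: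
  assumes N: "submodule K N V"
  shows "module K (quotient_module V N)"
proof -
  interpret submodule K N V by fact
  interpret V: module K V by (rule module)
  interpret N: abelian_subgroup N V by (rule submodule_abelian_subgroup) fact
  let ?Q = "quotient_module V N"
  note simps = quotient_add[OF N] quotient_smult[OF N] quotient_carrierI
  have zero: "\<zero>\<^bsub>?Q\<^esub> = N +>\<^bsub>V\<^esub> \<zero>\<^bsub>V\<^esub>"
    by (simp add: quotient_module_def N.a_rcos_const)
  show ?thesis
  proof (rule module_criteria, goal_cases)
    case 1 show ?case by unfold_locales
  next
    case 2 show ?case by (simp add: zero simps)
  next
    case 3 show ?case by (auto elim!: quotient_carrierE simp: simps)
  next
    case 4
    show ?case
    proof
      fix v assume "v \<in> carrier ?Q"
      then obtain x where x: "x \<in> carrier V" "v = N +>\<^bsub>V\<^esub> x" by (rule quotient_carrierE)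
      then have "v \<oplus>\<^bsub>?Q\<^esub> (N +>\<^bsub>V\<^esub> (\<ominus>\<^bsub>V\<^esub> x)) = \<zero>\<^bsub>?Q\<^esub>"
        by (simp add: simps zero V.M.r_neg)
      then show "\<exists>neg_v\<in>carrier ?Q. v \<oplus>\<^bsub>?Q\<^esub> neg_v = \<zero>\<^bsub>?Q\<^esub>"
        using x by (auto intro!: quotient_carrierI)
    qed
  qed (auto elim!: quotient_carrierE
        simp: simps zero V.M.a_ac V.smult_assoc1 V.smult_l_distr V.smult_r_distr)
qed

lemma tensor_relators_closed:
  assumes "module K U" "module K V"
  shows "tensor_relators K U V \<subseteq> carrier (free_module K (carrier U \<times> carrier V))"
proof -
  interpret U: module K U by fact
  interpret V: module K V by fact
  interpret F: module K "free_module K (carrier U \<times> carrier V)"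
    by (rule free_module_is_module) unfold_locales
  show ?thesis
    by (auto simp: tensor_relators_def Let_def)
qed

lemma tensor_kernel_submodule:
  assumes "module K U" "module K V"
  shows "submodule K (tensor_kernel K U V) (free_module K (carrier U \<times> carrier V))"
proof -
  interpret U: module K U by fact
  interpret F: module K "free_module K (carrier U \<times> carrier V)"
    by (rule free_module_is_module) unfold_locales
  show ?thesis unfolding tensor_kernel_def
    by (rule F.span_is_submodule[OF tensor_relators_closed[OF assms]])
qed

lemma tensor_is_module:
  assumes "module K U" "module K V"
  shows "module K (tensor K U V)"
  unfolding tensor_def by (rule quotient_is_module[OF tensor_kernel_submodule[OF assms]])

lemma tensor_is_vectorspace:
  assumes "vectorspace K U" "vectorspace K V"
  shows "vectorspace K (tensor K U V)"
  using assms tensor_is_module[of K U V] by (auto simp: vectorspace_def)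

lemma pure_tensor_closed:
  assumes "module K U" "u \<in> carrier U" "v \<in> carrier V"
  shows "pure_tensor K U V u v \<in> carrier (tensor K U V)"
proof -
  interpret U: module K U by fact
  show ?thesis unfolding pure_tensor_def tensor_def
    by (intro quotient_carrierI) simp
qed

lemma pure_tensor_bilinear:
  assumes U: "module K U" and V: "module K V"
  shows "bilinear_map K U V (tensor K U V) (pure_tensor K U V)"
proof -
  interpret U: module K U by fact
  interpret V: module K V by fact
  define S where "S = carrier U \<times> carrier V"
  define F where "F = free_module K S"
  define N where "N = tensor_kernel K U V"
  interpret F: module K F unfolding F_def
    by (rule free_module_is_module) unfold_locales
  have N: "submodule K N F" unfolding N_def F_def S_def by (rule tensor_kernel_submodule[OF U V])
  interpret N: abelian_subgroup N F by (rule submodule_abelian_subgroup[OF N])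
  have RC: "tensor_relators K U V \<subseteq> carrier F"
    using tensor_relators_closed[OF U V] by (simp add: F_def S_def)
  have RN: "tensor_relators K U V \<subseteq> N"
    using F.in_own_span[OF RC] by (simp add: N_def tensor_kernel_def F_def S_def)
  have e: "free_gen K S s \<in> carrier F" for s by (simp add: F_def)
  have eq: "N +>\<^bsub>F\<^esub> x = N +>\<^bsub>F\<^esub> y"
    if "x \<ominus>\<^bsub>F\<^esub> y \<in> tensor_relators K U V" "x \<in> carrier F" "y \<in> carrier F" for x y
    using that RN N.a_rcos_module[of y x] N.a_repr_independence'[of x y]
    by (auto simp: a_minus_def)
  have T: "tensor K U V = quotient_module F N"
    by (simp add: tensor_def F_def S_def N_def)
  have p: "pure_tensor K U V u v = N +>\<^bsub>F\<^esub> free_gen K S (u, v)" for u v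
    by (simp add: pure_tensor_def F_def S_def N_def)
  note R = tensor_relators_def[of K U V, unfolded Let_def, folded S_def, folded F_def]
  note q = quotient_add[OF N] quotient_smult[OF N]
  note cl = pure_tensor_closed[OF U]
  show ?thesis unfolding bilinear_map_def
  proof (intro conjI ballI)
    fix u assume u: "u \<in> carrier U"
    show "pure_tensor K U V u \<in> module_hom K V (tensor K U V)"
      unfolding module_hom_def
    proof (intro CollectI conjI allI impI funcsetI, goal_cases)
      case 1 then show ?case by (rule cl[OF u])
    next
      case (2 v v')
      then show ?case unfolding p T
        using u by (subst q(1)[OF e e]) (rule eq, unfold R, blast, simp_all add: e)
    next
      case (3 a v)
      then show ?case unfolding p T
        using u e by (subst q(2)) (simp_all, rule eq, unfold R, blast, simp_all)
    qed
  next
    fix v assume v: "v \<in> carrier V"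
    show "(\<lambda>u. pure_tensor K U V u v) \<in> module_hom K U (tensor K U V)"
      unfolding module_hom_def
    proof (intro CollectI conjI allI impI funcsetI, goal_cases)
      case (1 u) then show ?case by (rule cl[OF _ v])
    next
      case (2 u u')
      then show ?case unfolding p T
        using v by (subst q(1)[OF e e]) (rule eq, unfold R, blast, simp_all add: e)
    next
      case (3 a u)
      then show ?case unfolding p T
        using v e by (subst q(2)) (simp_all, rule eq, unfold R, blast, simp_all)
    qed
  qed
qed

lemma (in cring) free_induct [consumes 1, case_names gen add smult zero]:
  assumes f: "f \<in> carrier (free_module R S)"
    and gen: "\<And>s. s \<in> S \<Longrightarrow> P (free_gen R S s)"
    and add: "\<And>f g. f \<in> carrier (free_module R S) \<Longrightarrow> g \<in> carrier (free_module R S) \<Longrightarrow>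
      P f \<Longrightarrow> P g \<Longrightarrow> P (f \<oplus>\<^bsub>free_module R S\<^esub> g)"
    and smult: "\<And>c f. c \<in> carrier R \<Longrightarrow> f \<in> carrier (free_module R S) \<Longrightarrow>
      P f \<Longrightarrow> P (c \<odot>\<^bsub>free_module R S\<^esub> f)"
    and zero: "P \<zero>\<^bsub>free_module R S\<^esub>"
  shows "P f"
proof -
  interpret F: module R "free_module R S" by (rule free_module_is_module) unfold_locales
  have "P f" if "finite A" "f \<in> carrier (free_module R S)" "{s \<in> S. f s \<noteq> \<zero>} \<subseteq> A" "A \<subseteq> S" for A f
    using that
  proof (induction A arbitrary: f rule: finite_induct)
    case empty
    then have "f = \<zero>\<^bsub>free_module R S\<^esub>"
      by (auto simp: free_simps PiE_iff extensional_def restrict_def)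
    then show ?case using zero by simp
  next
    case (insert a A)
    define g where "g = (\<lambda>s\<in>S. if s = a then \<zero> else f s)"
    have f: "f \<in> S \<rightarrow>\<^sub>E carrier R" "finite {s \<in> S. f s \<noteq> \<zero>}" and a: "a \<in> S"
      using insert.prems by (auto simp: free_simps)
    have "finite {s \<in> S. g s \<noteq> \<zero>}" by (rule finite_subset[OF _ f(2)]) (auto simp: g_def)
    then have g: "g \<in> carrier (free_module R S)" using f by (auto simp: free_simps g_def)
    have "P g" using insert.prems g by (intro insert.IH[OF g]) (auto simp: g_def)
    moreover have "P (f a \<odot>\<^bsub>free_module R S\<^esub> free_gen R S a)"
      using f a by (intro smult gen) (auto simp: PiE_mem)
    ultimately have "P (g \<oplus>\<^bsub>free_module R S\<^esub> (f a \<odot>\<^bsub>free_module R S\<^esub> free_gen R S a))"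
      using f a g by (intro add F.smult_closed) (auto simp: PiE_mem)
    moreover have "g \<oplus>\<^bsub>free_module R S\<^esub> (f a \<odot>\<^bsub>free_module R S\<^esub> free_gen R S a) = f"
    proof
      fix s
      show "(g \<oplus>\<^bsub>free_module R S\<^esub> (f a \<odot>\<^bsub>free_module R S\<^esub> free_gen R S a)) s = f s"
        using PiE_mem[OF f(1)] PiE_arb[OF f(1), of s] a
        by (cases "s \<in> S") (auto simp: free_simps free_gen_def g_def)
    qed
    ultimately show ?case by simp
  qed
  from this[of "{s \<in> S. f s \<noteq> \<zero>}" f] f show ?thesis by (auto simp: free_simps)
qed

lemma tensor_hom_eqI:
  assumes U: "module K U" and V: "module K V" and W: "module K W"
    and g: "g \<in> module_hom K (tensor K U V) W" and h: "h \<in> module_hom K (tensor K U V) W"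
    and eq: "\<And>u v. u \<in> carrier U \<Longrightarrow> v \<in> carrier V \<Longrightarrow>
      g (pure_tensor K U V u v) = h (pure_tensor K U V u v)"
    and X: "X \<in> carrier (tensor K U V)"
  shows "g X = h X"
proof -
  interpret U: module K U by fact
  define S where "S = carrier U \<times> carrier V"
  define F where "F = free_module K S"
  define N where "N = tensor_kernel K U V"
  interpret F: module K F unfolding F_def
    by (rule free_module_is_module) unfold_locales
  have N: "submodule K N F" unfolding N_def F_def S_def by (rule tensor_kernel_submodule[OF U V])
  have T: "tensor K U V = quotient_module F N"
    by (simp add: tensor_def F_def S_def N_def)
  have p: "pure_tensor K U V u v = N +>\<^bsub>F\<^esub> free_gen K S (u, v)" for u v
    by (simp add: pure_tensor_def F_def S_def N_def)
  interpret g: mod_hom K "tensor K U V" W g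
    by (intro mod_hom.intro mod_hom_axioms.intro tensor_is_module assms)
  interpret h: mod_hom K "tensor K U V" W h
    by (intro mod_hom.intro mod_hom_axioms.intro tensor_is_module assms)
  have "g (N +>\<^bsub>F\<^esub> f) = h (N +>\<^bsub>F\<^esub> f)" if "f \<in> carrier (free_module K S)" for f
    using that
  proof (induction rule: U.R.free_induct)
    case (gen s)
    then show ?case using eq[of "fst s" "snd s"] by (auto simp: p S_def)
  next
    case (add f f')
    have cl: "f \<in> carrier F" "f' \<in> carrier F" using add by (simp_all add: F_def)
    have "N +>\<^bsub>F\<^esub> (f \<oplus>\<^bsub>F\<^esub> f') = (N +>\<^bsub>F\<^esub> f) \<oplus>\<^bsub>tensor K U V\<^esub> (N +>\<^bsub>F\<^esub> f')"
      unfolding T by (rule quotient_add[OF N cl, symmetric])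
    moreover have "N +>\<^bsub>F\<^esub> f \<in> carrier (tensor K U V)" "N +>\<^bsub>F\<^esub> f' \<in> carrier (tensor K U V)"
      using cl by (simp_all add: T quotient_carrierI)
    ultimately have "g (N +>\<^bsub>F\<^esub> (f \<oplus>\<^bsub>F\<^esub> f')) = h (N +>\<^bsub>F\<^esub> (f \<oplus>\<^bsub>F\<^esub> f'))"
      using add by (simp only: g.f_add h.f_add)
    then show ?case by (simp add: F_def)
  next
    case (smult c f)
    have cl: "c \<in> carrier K" "f \<in> carrier F" using smult by (simp_all add: F_def)
    have "N +>\<^bsub>F\<^esub> (c \<odot>\<^bsub>F\<^esub> f) = c \<odot>\<^bsub>tensor K U V\<^esub> (N +>\<^bsub>F\<^esub> f)"
      unfolding T by (rule quotient_smult[OF N cl, symmetric])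
    moreover have "N +>\<^bsub>F\<^esub> f \<in> carrier (tensor K U V)"
      using cl by (simp add: T quotient_carrierI)
    ultimately have "g (N +>\<^bsub>F\<^esub> (c \<odot>\<^bsub>F\<^esub> f)) = h (N +>\<^bsub>F\<^esub> (c \<odot>\<^bsub>F\<^esub> f))"
      using smult cl by (simp only: g.f_smult h.f_smult)
    then show ?case by (simp add: F_def)
  next
    case zero
    interpret N: abelian_subgroup N F by (rule submodule_abelian_subgroup[OF N])
    have "N +>\<^bsub>F\<^esub> \<zero>\<^bsub>F\<^esub> = \<zero>\<^bsub>tensor K U V\<^esub>"
      by (simp add: T quotient_module_def N.a_rcos_const)
    then show ?case by (simp add: F_def)
  qed
  then show ?thesis using X by (auto simp: T F_def elim!: quotient_carrierE)
qed

theorem tensor_universal: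
  assumes U: "module K U" and V: "module K V" and W: "module K W" and b: "bilinear_map K U V W b"
  shows "\<exists>!h. h \<in> module_hom K (tensor K U V) W \<and> h \<in> extensional (carrier (tensor K U V)) \<and>
    (\<forall>u\<in>carrier U. \<forall>v\<in>carrier V. h (pure_tensor K U V u v) = b u v)"
proof (rule ex_ex1I)
  interpret U: module K U by fact
  interpret V: module K V by fact
  interpret W: module K W by fact
  define S where "S = carrier U \<times> carrier V"
  define F where "F = free_module K S"
  define N where "N = tensor_kernel K U V"
  interpret F: module K F unfolding F_def
    by (rule free_module_is_module) unfold_locales
  have N: "submodule K N F" unfolding N_def F_def S_def by (rule tensor_kernel_submodule[OF U V])
  interpret N: submodule K N F by (rule N)
  interpret Ns: abelian_subgroup N F by (rule submodule_abelian_subgroup[OF N])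
  have T: "tensor K U V = quotient_module F N"
    by (simp add: tensor_def F_def S_def N_def)
  have p: "pure_tensor K U V u v = N +>\<^bsub>F\<^esub> free_gen K S (u, v)" for u v
    by (simp add: pure_tensor_def F_def S_def N_def)
  have e: "free_gen K S s \<in> carrier F" for s by (simp add: F_def)
  have b1: "b u \<in> module_hom K V W" if "u \<in> carrier U" for u
    using b that by (auto simp: bilinear_map_def)
  have b2: "(\<lambda>u. b u v) \<in> module_hom K U W" if "v \<in> carrier V" for v
    using b that by (auto simp: bilinear_map_def)
  have bc: "b u v \<in> carrier W" if "u \<in> carrier U" "v \<in> carrier V" for u v
    using module_hom_closed[OF b1[OF that(1)]] that(2) by auto
  define f where "f = free_lift K S W (\<lambda>s. b (fst s) (snd s))"
  have bS: "(\<lambda>s. b (fst s) (snd s)) \<in> S \<rightarrow> carrier W" using bc by (auto simp: S_def)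
  have f: "f \<in> module_hom K F W" unfolding f_def F_def by (rule W.free_lift_hom[OF bS])
  interpret f: mod_hom K F W f
    by (intro mod_hom.intro mod_hom_axioms.intro f) unfold_locales
  have fe: "f (free_gen K S (u, v)) = b u v" if "u \<in> carrier U" "v \<in> carrier V" for u v
    using W.free_lift_gen[OF bS, of "(u, v)"] that by (simp add: f_def S_def)
  have RC: "tensor_relators K U V \<subseteq> carrier F"
    using tensor_relators_closed[OF U V] by (simp add: F_def S_def)
  note R = tensor_relators_def[of K U V, unfolded Let_def, folded S_def, folded F_def]
  have "f r = \<zero>\<^bsub>W\<^esub>" if "r \<in> tensor_relators K U V" for r
    using that unfolding R
  proof (elim UnE CollectE exE conjE, goal_cases)
    case (1 u u' v)
    then show ?case using e module_hom_add[OF b2[of v], of u u'] by (simp add: fe bc)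
  next
    case (2 u v v')
    then show ?case using e module_hom_add[OF b1[of u], of v v'] by (simp add: fe bc)
  next
    case (3 a u v)
    then show ?case using e module_hom_smult[OF b2[of v], of a u] by (simp add: fe bc)
  next
    case (4 a u v)
    then show ?case using e module_hom_smult[OF b1[of u], of a v] by (simp add: fe bc)
  qed
  then have "tensor_relators K U V \<subseteq> f.ker" using RC by (auto simp: f.ker_def)
  then have "N \<subseteq> f.ker"
    unfolding N_def tensor_kernel_def S_def[symmetric] F_def[symmetric]
    by (rule F.span_is_subset[OF _ f.ker_is_submodule])
  then have fN: "f n = \<zero>\<^bsub>W\<^esub>" "n \<in> carrier F" if "n \<in> N" for n
    using that by (auto simp: f.ker_def)
  define h where "h = (\<lambda>X\<in>carrier (tensor K U V). f (SOME x. x \<in> X))"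
  have h: "h (N +>\<^bsub>F\<^esub> x) = f x" if x: "x \<in> carrier F" for x
  proof -
    have "(SOME y. y \<in> N +>\<^bsub>F\<^esub> x) \<in> N +>\<^bsub>F\<^esub> x"
      by (rule someI[of _ x]) (rule Ns.a_rcos_self[OF x])
    then obtain n where n: "n \<in> N" "(SOME y. y \<in> N +>\<^bsub>F\<^esub> x) = n \<oplus>\<^bsub>F\<^esub> x"
      unfolding a_r_coset_def' by blast
    then show ?thesis using x fN[of n] quotient_carrierI[OF x, of N]
      by (simp add: h_def T)
  qed
  have "h \<in> module_hom K (tensor K U V) W"
    unfolding module_hom_def T
    by (auto elim!: quotient_carrierE simp: h quotient_add[OF N] quotient_smult[OF N])
  moreover have "h (pure_tensor K U V u v) = b u v" if "u \<in> carrier U" "v \<in> carrier V" for u v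
    using that by (simp add: p h e fe)
  ultimately show "\<exists>h. h \<in> module_hom K (tensor K U V) W \<and>
      h \<in> extensional (carrier (tensor K U V)) \<and>
      (\<forall>u\<in>carrier U. \<forall>v\<in>carrier V. h (pure_tensor K U V u v) = b u v)"
    by (intro exI[of _ h]) (auto simp: h_def)
next
  fix g h
  assume g: "g \<in> module_hom K (tensor K U V) W \<and> g \<in> extensional (carrier (tensor K U V)) \<and>
    (\<forall>u\<in>carrier U. \<forall>v\<in>carrier V. g (pure_tensor K U V u v) = b u v)"
  assume h: "h \<in> module_hom K (tensor K U V) W \<and> h \<in> extensional (carrier (tensor K U V)) \<and>
    (\<forall>u\<in>carrier U. \<forall>v\<in>carrier V. h (pure_tensor K U V u v) = b u v)"
  show "g = h"
  proof (rule extensionalityI)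
    fix X assume "X \<in> carrier (tensor K U V)"
    then show "g X = h X" using g h by (intro tensor_hom_eqI[OF U V W, of g h X]) simp_all
  qed (use g h in blast)+
qed

lemma tensor_lift:
  assumes "module K U" "module K V" "module K W" "bilinear_map K U V W b"
  shows "tensor_lift K U V W b \<in> module_hom K (tensor K U V) W"
    and "u \<in> carrier U \<Longrightarrow> v \<in> carrier V \<Longrightarrow>
      tensor_lift K U V W b (pure_tensor K U V u v) = b u v"
  using theI'[OF tensor_universal[OF assms]] unfolding tensor_lift_def by auto

lemma pure_tensor_simps:
  assumes "module K U" "module K V"
  shows "u \<in> carrier U \<Longrightarrow> u' \<in> carrier U \<Longrightarrow> v \<in> carrier V \<Longrightarrow>
      pure_tensor K U V (u \<oplus>\<^bsub>U\<^esub> u') v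
        = pure_tensor K U V u v \<oplus>\<^bsub>tensor K U V\<^esub> pure_tensor K U V u' v"
    and "u \<in> carrier U \<Longrightarrow> v \<in> carrier V \<Longrightarrow> v' \<in> carrier V \<Longrightarrow>
      pure_tensor K U V u (v \<oplus>\<^bsub>V\<^esub> v')
        = pure_tensor K U V u v \<oplus>\<^bsub>tensor K U V\<^esub> pure_tensor K U V u v'"
    and "a \<in> carrier K \<Longrightarrow> u \<in> carrier U \<Longrightarrow> v \<in> carrier V \<Longrightarrow>
      pure_tensor K U V (a \<odot>\<^bsub>U\<^esub> u) v = a \<odot>\<^bsub>tensor K U V\<^esub> pure_tensor K U V u v"
    and "a \<in> carrier K \<Longrightarrow> u \<in> carrier U \<Longrightarrow> v \<in> carrier V \<Longrightarrow>
      pure_tensor K U V u (a \<odot>\<^bsub>V\<^esub> v) = a \<odot>\<^bsub>tensor K U V\<^esub> pure_tensor K U V u v"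
  using pure_tensor_bilinear[OF assms] by (auto simp: bilinear_map_def module_hom_def)

section \<open>Maps between tensor products\<close>

definition tensor_map ::
  "('k, 'm) ring_scheme \<Rightarrow> ('k, 'u, 'n1) module_scheme \<Rightarrow> ('k, 'v, 'n2) module_scheme
    \<Rightarrow> ('k, 'u1, 'n3) module_scheme \<Rightarrow> ('k, 'v1, 'n4) module_scheme
    \<Rightarrow> ('u \<Rightarrow> 'u1) \<Rightarrow> ('v \<Rightarrow> 'v1) \<Rightarrow> ('u \<times> 'v \<Rightarrow> 'k) set \<Rightarrow> ('u1 \<times> 'v1 \<Rightarrow> 'k) set" where
  "tensor_map K U V U' V' f g =
     tensor_lift K U V (tensor K U' V') (\<lambda>u v. pure_tensor K U' V' (f u) (g v))"

definition tensor_swap ::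
  "('k, 'm) ring_scheme \<Rightarrow> ('k, 'u, 'n1) module_scheme \<Rightarrow> ('k, 'v, 'n2) module_scheme
    \<Rightarrow> ('u \<times> 'v \<Rightarrow> 'k) set \<Rightarrow> ('v \<times> 'u \<Rightarrow> 'k) set" where
  "tensor_swap K U V = tensor_lift K U V (tensor K V U) (\<lambda>u v. pure_tensor K V U v u)"

text \<open>The associativity isomorphism from \<open>(U \<otimes> V) \<otimes> W\<close> to \<open>U \<otimes> (V \<otimes> W)\<close> and its inverse.\<close>

definition tensor_assoc ::
  "('k, 'm) ring_scheme \<Rightarrow> ('k, 'u, 'n1) module_scheme \<Rightarrow> ('k, 'v, 'n2) module_scheme
    \<Rightarrow> ('k, 'w, 'n3) module_scheme
    \<Rightarrow> (('u \<times> 'v \<Rightarrow> 'k) set \<times> 'w \<Rightarrow> 'k) set \<Rightarrow> ('u \<times> ('v \<times> 'w \<Rightarrow> 'k) set \<Rightarrow> 'k) set" where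
  "tensor_assoc K U V W =
     tensor_lift K (tensor K U V) W (tensor K U (tensor K V W))
       (\<lambda>t w. tensor_lift K U V (tensor K U (tensor K V W))
         (\<lambda>u v. pure_tensor K U (tensor K V W) u (pure_tensor K V W v w)) t)"

definition tensor_assoc_inv ::
  "('k, 'm) ring_scheme \<Rightarrow> ('k, 'u, 'n1) module_scheme \<Rightarrow> ('k, 'v, 'n2) module_scheme
    \<Rightarrow> ('k, 'w, 'n3) module_scheme
    \<Rightarrow> ('u \<times> ('v \<times> 'w \<Rightarrow> 'k) set \<Rightarrow> 'k) set \<Rightarrow> (('u \<times> 'v \<Rightarrow> 'k) set \<times> 'w \<Rightarrow> 'k) set" where
  "tensor_assoc_inv K U V W =
     tensor_lift K U (tensor K V W) (tensor K (tensor K U V) W)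
       (\<lambda>u t. tensor_lift K V W (tensor K (tensor K U V) W)
         (\<lambda>v w. pure_tensor K (tensor K U V) W (pure_tensor K U V u v) w) t)"

text \<open>Threefold tensors live in \<open>C \<otimes> (C \<otimes> C)\<close>; maps into \<open>(C \<otimes> C) \<otimes> C\<close> are composed with
  \<^const>\<open>tensor_assoc\<close>.\<close>

abbreviation tensor2 where "tensor2 K C \<equiv> tensor K C C"

abbreviation tensor3 where "tensor3 K C \<equiv> tensor K C (tensor2 K C)"

abbreviation tau where "tau K C \<equiv> tensor_swap K C C"

text \<open>The map \<open>\<xi>\<close>, sending \<open>x \<otimes> (y \<otimes> z)\<close> to \<open>y \<otimes> (z \<otimes> x)\<close>.\<close>

definition xi ::
  "('k, 'm) ring_scheme \<Rightarrow> ('k, 'c, 'n) module_scheme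
    \<Rightarrow> ('c \<times> ('c \<times> 'c \<Rightarrow> 'k) set \<Rightarrow> 'k) set \<Rightarrow> ('c \<times> ('c \<times> 'c \<Rightarrow> 'k) set \<Rightarrow> 'k) set" where
  "xi K C =
     tensor_lift K C (tensor2 K C) (tensor3 K C)
       (\<lambda>x t. tensor_lift K C C (tensor3 K C)
         (\<lambda>y z. pure_tensor K C (tensor2 K C) y (pure_tensor K C C z x)) t)"

definition tau_id ::
  "('k, 'm) ring_scheme \<Rightarrow> ('k, 'c, 'n) module_scheme
    \<Rightarrow> ('c \<times> ('c \<times> 'c \<Rightarrow> 'k) set \<Rightarrow> 'k) set \<Rightarrow> ('c \<times> ('c \<times> 'c \<Rightarrow> 'k) set \<Rightarrow> 'k) set" where
  "tau_id K C =
     tensor_assoc K C C C \<circ> tensor_map K (tensor2 K C) C (tensor2 K C) C (tau K C) id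
       \<circ> tensor_assoc_inv K C C C"

text \<open>For \<open>f : C \<rightarrow> C\<close> and \<open>g : C \<rightarrow> C \<otimes> C\<close>, the maps \<open>f \<otimes> g\<close> and \<open>g \<otimes> f\<close>
  from \<open>C \<otimes> C\<close> to \<open>C \<otimes> (C \<otimes> C)\<close>.\<close>

definition tensor_right ::
  "('k, 'm) ring_scheme \<Rightarrow> ('k, 'c, 'n) module_scheme
    \<Rightarrow> ('c \<Rightarrow> 'c) \<Rightarrow> ('c \<Rightarrow> ('c \<times> 'c \<Rightarrow> 'k) set)
    \<Rightarrow> ('c \<times> 'c \<Rightarrow> 'k) set \<Rightarrow> ('c \<times> ('c \<times> 'c \<Rightarrow> 'k) set \<Rightarrow> 'k) set" where
  "tensor_right K C f g = tensor_map K C C C (tensor2 K C) f g"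

definition tensor_left ::
  "('k, 'm) ring_scheme \<Rightarrow> ('k, 'c, 'n) module_scheme
    \<Rightarrow> ('c \<Rightarrow> ('c \<times> 'c \<Rightarrow> 'k) set) \<Rightarrow> ('c \<Rightarrow> 'c)
    \<Rightarrow> ('c \<times> 'c \<Rightarrow> 'k) set \<Rightarrow> ('c \<times> ('c \<times> 'c \<Rightarrow> 'k) set \<Rightarrow> 'k) set" where
  "tensor_left K C g f = tensor_assoc K C C C \<circ> tensor_map K C C (tensor2 K C) C g f"

section \<open>Post-Hom-Lie coalgebras\<close>

definition hom_co_jacobi ::
  "('k, 'm) ring_scheme \<Rightarrow> ('k, 'c, 'n) module_scheme
    \<Rightarrow> ('c \<Rightarrow> 'c) \<Rightarrow> ('c \<Rightarrow> ('c \<times> 'c \<Rightarrow> 'k) set) \<Rightarrow> bool" where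
  "hom_co_jacobi K C \<alpha> \<gamma> \<longleftrightarrow>
     (\<forall>x\<in>carrier C. let t = tensor_right K C \<alpha> \<gamma> (\<gamma> x) in
        t \<oplus>\<^bsub>tensor3 K C\<^esub> xi K C t \<oplus>\<^bsub>tensor3 K C\<^esub> xi K C (xi K C t) = \<zero>\<^bsub>tensor3 K C\<^esub>)"

locale post_hom_lie_coalgebra = vectorspace K C
  for K (structure) and C (structure) +
  fixes \<Delta> \<gamma> :: "'c \<Rightarrow> ('c \<times> 'c \<Rightarrow> 'a) set" and \<alpha> :: "'c \<Rightarrow> 'c"
  assumes \<Delta>_linear: "\<Delta> \<in> module_hom K C (tensor2 K C)"
    and \<gamma>_linear: "\<gamma> \<in> module_hom K C (tensor2 K C)"
    and \<alpha>_linear: "\<alpha> \<in> module_hom K C C"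
    and skew: "x \<in> carrier C \<Longrightarrow> \<gamma> x = \<ominus>\<^bsub>tensor2 K C\<^esub> tau K C (\<gamma> x)"
    and multiplicative: "x \<in> carrier C \<Longrightarrow> \<gamma> (\<alpha> x) = tensor_map K C C C C \<alpha> \<alpha> (\<gamma> x)"
    and co_jacobi: "hom_co_jacobi K C \<alpha> \<gamma>"
    and coderivation: "x \<in> carrier C \<Longrightarrow>
      tensor_right K C \<alpha> \<gamma> (\<Delta> x)
        \<ominus>\<^bsub>tensor3 K C\<^esub> tensor_left K C \<Delta> \<alpha> (\<gamma> x)
        \<ominus>\<^bsub>tensor3 K C\<^esub> tau_id K C (tensor_right K C \<alpha> \<Delta> (\<gamma> x)) = \<zero>\<^bsub>tensor3 K C\<^esub>"
    and coassociator: "x \<in> carrier C \<Longrightarrow>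
      tensor_left K C \<Delta> \<alpha> (\<Delta> x)
        \<ominus>\<^bsub>tensor3 K C\<^esub> tensor_right K C \<alpha> \<Delta> (\<Delta> x)
        \<ominus>\<^bsub>tensor3 K C\<^esub> tau_id K C (tensor_left K C \<Delta> \<alpha> (\<Delta> x))
        \<oplus>\<^bsub>tensor3 K C\<^esub> tau_id K C (tensor_right K C \<alpha> \<Delta> (\<Delta> x))
        \<oplus>\<^bsub>tensor3 K C\<^esub> tensor_left K C \<gamma> \<alpha> (\<Delta> x) = \<zero>\<^bsub>tensor3 K C\<^esub>"

text \<open>Admissibility of \<open>\<Delta>\<close> asks for the Hom-co-Jacobi identity of \<open>(1 - \<tau>) \<circ> \<Delta>\<close>, whose
  skew-symmetry is automatic. Multiplicativity of \<open>\<alpha>\<close> is not part of it.\<close>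

locale admissible_hom_lie_coalgebra = vectorspace K C
  for K (structure) and C (structure) +
  fixes \<Delta> :: "'c \<Rightarrow> ('c \<times> 'c \<Rightarrow> 'a) set" and \<alpha> :: "'c \<Rightarrow> 'c"
  assumes \<Delta>_linear: "\<Delta> \<in> module_hom K C (tensor2 K C)"
    and \<alpha>_linear: "\<alpha> \<in> module_hom K C C"
    and co_jacobi:
      "hom_co_jacobi K C \<alpha> (\<lambda>x. \<Delta> x \<ominus>\<^bsub>tensor2 K C\<^esub> tau K C (\<Delta> x))"

end

(* Put N = 1 + \<xi> + \<xi>^2, \<sigma> = \<tau> \<otimes> I, and let R f = \<alpha> \<otimes> f, L f = f \<otimes> \<alpha>. Then I \<otimes> \<tau> = \<xi> \<sigma>,
   R f \<tau> = \<xi>^2 (L f) and \<sigma> \<xi>^2 = \<xi> \<sigma>, while N \<xi> = N. As \<gamma> is skew, (1 - \<tau>) (\<Delta> + \<gamma>/2) = \<Delta> - \<tau> \<Delta> + \<gamma>, so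
   N annihilates the Hom-co-Jacobi expression: absorbing the powers of \<xi>, what is left is N applied to
   minus the left side of coassociator, plus that of coderivation (where N (L \<Delta> \<gamma>) = - N (R \<Delta> \<gamma>) by
   skewness), plus R \<gamma> \<gamma>. *)
theory Submission
  imports Defs
begin

section \<open>Closure properties of linear maps, and linearity of tensor constructions in a
  parameter\<close>

section \<open>Linear maps\<close>

lemma module_hom_mem:
  assumes "f \<in> module_hom K U V" "x \<in> carrier U"
  shows "f x \<in> carrier V"
  using assms by (auto simp: module_hom_def)

lemma mod_homI:
  assumes "module K U" "module K V" "f \<in> module_hom K U V"
  shows "mod_hom K U V f"
  using assms by (simp add: mod_hom_def mod_hom_axioms_def)

lemma module_hom_id: "(\<lambda>x. x) \<in> module_hom K U U"
  by (simp add: module_hom_def)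

lemma module_hom_compose:
  assumes "f \<in> module_hom K U V" "g \<in> module_hom K V W"
  shows "(\<lambda>x. g (f x)) \<in> module_hom K U W"
  using assms by (auto simp: module_hom_def Pi_iff)

lemma module_hom_plus:
  assumes "module K W" "f \<in> module_hom K U W" "g \<in> module_hom K U W"
  shows "(\<lambda>x. f x \<oplus>\<^bsub>W\<^esub> g x) \<in> module_hom K U W"
proof -
  interpret W: module K W by fact
  show ?thesis
    using assms(2,3) by (auto simp: module_hom_def Pi_iff W.M.a_ac W.smult_r_distr)
qed

lemma module_hom_scale:
  assumes "module K W" "c \<in> carrier K" "f \<in> module_hom K U W"
  shows "(\<lambda>x. c \<odot>\<^bsub>W\<^esub> f x) \<in> module_hom K U W"
proof -
  interpret W: module K W by fact
  have "c \<odot>\<^bsub>W\<^esub> (a \<odot>\<^bsub>W\<^esub> w) = a \<odot>\<^bsub>W\<^esub> (c \<odot>\<^bsub>W\<^esub> w)"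
    if "a \<in> carrier K" "w \<in> carrier W" for a w
    using assms(2) that by (simp add: W.smult_assoc1[symmetric] W.R.m_comm)
  then show ?thesis
    using assms(2,3) by (auto simp: module_hom_def Pi_iff W.smult_r_distr)
qed

lemma module_hom_uminus:
  assumes "module K W" "f \<in> module_hom K U W"
  shows "(\<lambda>x. \<ominus>\<^bsub>W\<^esub> f x) \<in> module_hom K U W"
proof -
  interpret W: module K W by fact
  show ?thesis
    using assms(2) by (auto simp: module_hom_def Pi_iff W.M.minus_add W.smult_r_minus)
qed

lemma module_hom_diff:
  assumes "module K W" "f \<in> module_hom K U W" "g \<in> module_hom K U W"
  shows "(\<lambda>x. f x \<ominus>\<^bsub>W\<^esub> g x) \<in> module_hom K U W"
  unfolding a_minus_def by (intro module_hom_plus module_hom_uminus assms)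

text \<open>The inner map \<open>f\<close> is kept general so that this rule and its right-hand twin
  can be nested; linearity of an iterated pure tensor in any one of its factors then comes from
  resolution alone.\<close>

lemma pure_tensor_hom_left:
  assumes "module K U" "module K V" "f \<in> module_hom K X U" "v \<in> carrier V"
  shows "(\<lambda>x. pure_tensor K U V (f x) v) \<in> module_hom K X (tensor K U V)"
  using pure_tensor_bilinear[OF assms(1,2)] assms(4)
  by (intro module_hom_compose[OF assms(3)]) (auto simp: bilinear_map_def)

lemma pure_tensor_hom_right:
  assumes "module K U" "module K V" "f \<in> module_hom K X V" "u \<in> carrier U"
  shows "(\<lambda>x. pure_tensor K U V u (f x)) \<in> module_hom K X (tensor K U V)"
  using pure_tensor_bilinear[OF assms(1,2)] assms(4)
  by (intro module_hom_compose[OF assms(3)]) (auto simp: bilinear_map_def)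

text \<open>For a fixed tensor \<open>t\<close> nothing is known about \<open>t\<close> as a
  combination of pure tensors. The two sides of additivity in \<open>x\<close> are therefore read as
  linear maps of \<open>t\<close>, and these agree on pure tensors by \<open>lin\<close>; scaling is
  treated alike. This gives the linearity of nested lifts in their outer argument.\<close>

lemma tensor_lift_hom_param:
  assumes U: "module K U" and V: "module K V" and W: "module K W" and X: "module K X"
    and b: "\<And>x. x \<in> carrier X \<Longrightarrow> bilinear_map K U V W (b x)"
    and lin: "\<And>u v. u \<in> carrier U \<Longrightarrow> v \<in> carrier V \<Longrightarrow> (\<lambda>x. b x u v) \<in> module_hom K X W"
    and t: "t \<in> carrier (tensor K U V)"
  shows "(\<lambda>x. tensor_lift K U V W (b x) t) \<in> module_hom K X W"
proof -
  interpret X: module K X by fact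
  note l = tensor_lift[OF U V W b]
  show ?thesis unfolding module_hom_def
  proof (intro CollectI conjI allI impI funcsetI, goal_cases)
    case (1 x) then show ?case using t by (intro module_hom_mem[OF l(1)])
  next
    case (2 x y)
    then have xy: "x \<oplus>\<^bsub>X\<^esub> y \<in> carrier X" by simp
    \<comment> \<open>The competitor for uniqueness: the sum of the two lifts is again linear in
      \<open>t\<close>, so it can be compared with the lift of \<open>b (x + y)\<close>.\<close>
    have "(\<lambda>t. tensor_lift K U V W (b x) t \<oplus>\<^bsub>W\<^esub> tensor_lift K U V W (b y) t)
        \<in> module_hom K (tensor K U V) W"
      using 2 by (intro module_hom_plus[OF W] l(1)) simp_all
    from tensor_hom_eqI[OF U V W l(1)[OF xy] this _ t] show ?case
      using 2 xy by (simp add: l(2) module_hom_add[OF lin])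
  next
    case (3 a x)
    then have ax: "a \<odot>\<^bsub>X\<^esub> x \<in> carrier X" by simp
    have "(\<lambda>t. a \<odot>\<^bsub>W\<^esub> tensor_lift K U V W (b x) t) \<in> module_hom K (tensor K U V) W"
      using 3 by (intro module_hom_scale[OF W] l(1)) simp_all
    from tensor_hom_eqI[OF U V W l(1)[OF ax] this _ t] show ?case
      using 3 ax by (simp add: l(2) module_hom_smult[OF lin])
  qed
qed

section \<open>The maps between tensor products: linearity and values on pure tensors\<close>

section \<open>Structure maps of tensor products\<close>

lemma tensor_map:
  assumes U: "module K U" and V: "module K V" and U': "module K U'" and V': "module K V'"
    and f: "f \<in> module_hom K U U'" and g: "g \<in> module_hom K V V'"
  shows "tensor_map K U V U' V' f g \<in> module_hom K (tensor K U V) (tensor K U' V')"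
    and "u \<in> carrier U \<Longrightarrow> v \<in> carrier V \<Longrightarrow>
      tensor_map K U V U' V' f g (pure_tensor K U V u v) = pure_tensor K U' V' (f u) (g v)"
proof -
  have "bilinear_map K U V (tensor K U' V') (\<lambda>u v. pure_tensor K U' V' (f u) (g v))"
    unfolding bilinear_map_def
    by (blast intro: pure_tensor_hom_left[OF U' V' f] pure_tensor_hom_right[OF U' V' g]
        module_hom_mem[OF f] module_hom_mem[OF g])
  from tensor_lift[OF U V tensor_is_module[OF U' V'] this]
  show "tensor_map K U V U' V' f g \<in> module_hom K (tensor K U V) (tensor K U' V')"
    and "u \<in> carrier U \<Longrightarrow> v \<in> carrier V \<Longrightarrow>
      tensor_map K U V U' V' f g (pure_tensor K U V u v) = pure_tensor K U' V' (f u) (g v)"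
    by (simp_all add: tensor_map_def)
qed

lemma tensor_swap:
  assumes U: "module K U" and V: "module K V"
  shows "tensor_swap K U V \<in> module_hom K (tensor K U V) (tensor K V U)"
    and "u \<in> carrier U \<Longrightarrow> v \<in> carrier V \<Longrightarrow>
      tensor_swap K U V (pure_tensor K U V u v) = pure_tensor K V U v u"
proof -
  have "bilinear_map K U V (tensor K V U) (\<lambda>u v. pure_tensor K V U v u)"
    using pure_tensor_bilinear[OF V U] by (simp add: bilinear_map_def)
  from tensor_lift[OF U V tensor_is_module[OF V U] this]
  show "tensor_swap K U V \<in> module_hom K (tensor K U V) (tensor K V U)"
    and "u \<in> carrier U \<Longrightarrow> v \<in> carrier V \<Longrightarrow>
      tensor_swap K U V (pure_tensor K U V u v) = pure_tensor K V U v u"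
    by (simp_all add: tensor_swap_def)
qed

text \<open>The outer map is bilinear for two different reasons: in \<open>t\<close> it is linear as
  a lift for fixed \<open>w\<close>, and in \<open>w\<close> by
  \<open>tensor_lift_hom_param\<close>. The inverse and \<open>xi\<close> follow the same pattern,
  with the left factor as the parameter.\<close>

lemma tensor_assoc:
  assumes U: "module K U" and V: "module K V" and W: "module K W"
  shows "tensor_assoc K U V W
      \<in> module_hom K (tensor K (tensor K U V) W) (tensor K U (tensor K V W))"
    and "u \<in> carrier U \<Longrightarrow> v \<in> carrier V \<Longrightarrow> w \<in> carrier W \<Longrightarrow>
      tensor_assoc K U V W (pure_tensor K (tensor K U V) W (pure_tensor K U V u v) w)
        = pure_tensor K U (tensor K V W) u (pure_tensor K V W v w)"
proof -
  let ?T = "tensor K U (tensor K V W)"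
  let ?p = "\<lambda>u v w. pure_tensor K U (tensor K V W) u (pure_tensor K V W v w)"
  let ?b = "\<lambda>t w. tensor_lift K U V ?T (\<lambda>u v. ?p u v w) t"
  note UV = tensor_is_module[OF U V] and VW = tensor_is_module[OF V W]
  note T = tensor_is_module[OF U VW]
  \<comment> \<open>The first three facts are linearity of \<open>?p\<close> in \<open>u\<close>, in
    \<open>v\<close> and in \<open>w\<close>; the last one puts the inner pure tensor into its
    carrier.\<close>
  note h = pure_tensor_hom_left[OF U VW module_hom_id]
    pure_tensor_hom_right[OF U VW pure_tensor_hom_left[OF V W module_hom_id]]
    pure_tensor_hom_right[OF U VW pure_tensor_hom_right[OF V W module_hom_id]]
    pure_tensor_closed[OF V]
  have bil: "bilinear_map K U V ?T (\<lambda>u v. ?p u v w)" if "w \<in> carrier W" for w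
    unfolding bilinear_map_def using that by (blast intro: h)
  have "bilinear_map K (tensor K U V) W ?T ?b" unfolding bilinear_map_def
  proof (intro conjI ballI)
    fix t assume "t \<in> carrier (tensor K U V)"
    then show "?b t \<in> module_hom K W ?T"
      by (intro tensor_lift_hom_param[OF U V T W bil]) (auto intro: h)
  next
    fix w assume "w \<in> carrier W"
    then show "(\<lambda>t. ?b t w) \<in> module_hom K (tensor K U V) ?T"
      using tensor_lift(1)[OF U V T bil] by simp
  qed
  note l = tensor_lift[OF UV W T this]
  show "tensor_assoc K U V W \<in> module_hom K (tensor K (tensor K U V) W) ?T"
    using l(1) by (simp add: tensor_assoc_def)
  assume "u \<in> carrier U" "v \<in> carrier V" "w \<in> carrier W"
  then show "tensor_assoc K U V W (pure_tensor K (tensor K U V) W (pure_tensor K U V u v) w)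
      = ?p u v w"
    by (simp add: tensor_assoc_def l(2) tensor_lift(2)[OF U V T bil] pure_tensor_closed[OF U])
qed

lemma tensor_assoc_inv:
  assumes U: "module K U" and V: "module K V" and W: "module K W"
  shows "tensor_assoc_inv K U V W
      \<in> module_hom K (tensor K U (tensor K V W)) (tensor K (tensor K U V) W)"
    and "u \<in> carrier U \<Longrightarrow> v \<in> carrier V \<Longrightarrow> w \<in> carrier W \<Longrightarrow>
      tensor_assoc_inv K U V W (pure_tensor K U (tensor K V W) u (pure_tensor K V W v w))
        = pure_tensor K (tensor K U V) W (pure_tensor K U V u v) w"
proof -
  let ?T = "tensor K (tensor K U V) W"
  let ?p = "\<lambda>u v w. pure_tensor K (tensor K U V) W (pure_tensor K U V u v) w"
  let ?b = "\<lambda>u t. tensor_lift K V W ?T (\<lambda>v w. ?p u v w) t"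
  note UV = tensor_is_module[OF U V] and VW = tensor_is_module[OF V W]
  note T = tensor_is_module[OF UV W]
  note h = pure_tensor_hom_right[OF UV W module_hom_id]
    pure_tensor_hom_left[OF UV W pure_tensor_hom_left[OF U V module_hom_id]]
    pure_tensor_hom_left[OF UV W pure_tensor_hom_right[OF U V module_hom_id]]
    pure_tensor_closed[OF U]
  have bil: "bilinear_map K V W ?T (\<lambda>v w. ?p u v w)" if "u \<in> carrier U" for u
    unfolding bilinear_map_def using that by (blast intro: h)
  have "bilinear_map K U (tensor K V W) ?T ?b" unfolding bilinear_map_def
  proof (intro conjI ballI)
    fix t assume "t \<in> carrier (tensor K V W)"
    then show "(\<lambda>u. ?b u t) \<in> module_hom K U ?T"
      by (intro tensor_lift_hom_param[OF V W T U bil]) (auto intro: h)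
  next
    fix u assume "u \<in> carrier U"
    then show "?b u \<in> module_hom K (tensor K V W) ?T"
      using tensor_lift(1)[OF V W T bil] by simp
  qed
  note l = tensor_lift[OF U VW T this]
  show "tensor_assoc_inv K U V W \<in> module_hom K (tensor K U (tensor K V W)) ?T"
    using l(1) by (simp add: tensor_assoc_inv_def)
  assume "u \<in> carrier U" "v \<in> carrier V" "w \<in> carrier W"
  then show "tensor_assoc_inv K U V W (pure_tensor K U (tensor K V W) u (pure_tensor K V W v w))
      = ?p u v w"
    by (simp add: tensor_assoc_inv_def l(2) tensor_lift(2)[OF V W T bil] pure_tensor_closed[OF V])
qed

section \<open>Threefold tensors of one module: the cyclic shift and the transposition of the first
  two factors\<close>

context module
begin

lemma tensor2_module: "module R (tensor2 R M)"
  by (intro tensor_is_module module_axioms)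

lemma tensor3_module: "module R (tensor3 R M)"
  by (intro tensor_is_module tensor2_module module_axioms)

lemmas pure2_closed = pure_tensor_closed[OF module_axioms, where V = M]

text \<open>Uniqueness is used twice: first to reduce to tensors of \<open>x\<close> with an
  arbitrary \<open>t\<close>, then, with \<open>x\<close> fixed, for the two maps as linear
  functions of \<open>t\<close>. Identities among \<open>xi\<close> and \<open>tau_id\<close>
  thereby become identities of permutations of three letters.\<close>

lemma tensor3_hom_eqI:
  assumes W: "module R W"
    and g: "g \<in> module_hom R (tensor3 R M) W" and h: "h \<in> module_hom R (tensor3 R M) W"
    and eq: "\<And>x y z. x \<in> carrier M \<Longrightarrow> y \<in> carrier M \<Longrightarrow> z \<in> carrier M \<Longrightarrow>
      g (pure_tensor R M (tensor2 R M) x (pure_tensor R M M y z))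
        = h (pure_tensor R M (tensor2 R M) x (pure_tensor R M M y z))"
    and s: "s \<in> carrier (tensor3 R M)"
  shows "g s = h s"
proof (rule tensor_hom_eqI[OF module_axioms tensor2_module W g h _ s])
  fix x t assume x: "x \<in> carrier M" and t: "t \<in> carrier (tensor2 R M)"
  note p = pure_tensor_hom_right[OF module_axioms tensor2_module module_hom_id x]
  show "g (pure_tensor R M (tensor2 R M) x t) = h (pure_tensor R M (tensor2 R M) x t)"
    using tensor_hom_eqI[OF module_axioms module_axioms W module_hom_compose[OF p g]
        module_hom_compose[OF p h] eq[OF x] t] .
qed

lemma xi:
  shows "xi R M \<in> module_hom R (tensor3 R M) (tensor3 R M)"
    and "x \<in> carrier M \<Longrightarrow> y \<in> carrier M \<Longrightarrow> z \<in> carrier M \<Longrightarrow>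
      xi R M (pure_tensor R M (tensor2 R M) x (pure_tensor R M M y z))
        = pure_tensor R M (tensor2 R M) y (pure_tensor R M M z x)"
proof -
  let ?p = "\<lambda>x y z. pure_tensor R M (tensor2 R M) y (pure_tensor R M M z x)"
  let ?b = "\<lambda>x t. tensor_lift R M M (tensor3 R M) (\<lambda>y z. ?p x y z) t"
  note m = module_axioms and T2 = tensor2_module and T3 = tensor3_module
  note h = pure_tensor_hom_left[OF m T2 module_hom_id]
    pure_tensor_hom_right[OF m T2 pure_tensor_hom_left[OF m m module_hom_id]]
    pure_tensor_hom_right[OF m T2 pure_tensor_hom_right[OF m m module_hom_id]]
    pure_tensor_closed[OF m]
  have bil: "bilinear_map R M M (tensor3 R M) (\<lambda>y z. ?p x y z)" if "x \<in> carrier M" for x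
    unfolding bilinear_map_def using that by (blast intro: h)
  have "bilinear_map R M (tensor2 R M) (tensor3 R M) ?b" unfolding bilinear_map_def
  proof (intro conjI ballI)
    fix t assume "t \<in> carrier (tensor2 R M)"
    then show "(\<lambda>x. ?b x t) \<in> module_hom R M (tensor3 R M)"
      by (intro tensor_lift_hom_param[OF m m T3 m bil]) (auto intro: h)
  next
    fix x assume "x \<in> carrier M"
    then show "?b x \<in> module_hom R (tensor2 R M) (tensor3 R M)"
      using tensor_lift(1)[OF m m T3 bil] by simp
  qed
  note l = tensor_lift[OF m T2 T3 this]
  show "xi R M \<in> module_hom R (tensor3 R M) (tensor3 R M)"
    using l(1) by (simp add: xi_def)
  assume "x \<in> carrier M" "y \<in> carrier M" "z \<in> carrier M"
  then show "xi R M (pure_tensor R M (tensor2 R M) x (pure_tensor R M M y z)) = ?p x y z"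
    by (simp add: xi_def l(2) tensor_lift(2)[OF m m T3 bil] pure2_closed)
qed

lemmas tau = tensor_swap[OF module_axioms module_axioms]

lemma tau_id:
  shows "tau_id R M \<in> module_hom R (tensor3 R M) (tensor3 R M)"
    and "x \<in> carrier M \<Longrightarrow> y \<in> carrier M \<Longrightarrow> z \<in> carrier M \<Longrightarrow>
      tau_id R M (pure_tensor R M (tensor2 R M) x (pure_tensor R M M y z))
        = pure_tensor R M (tensor2 R M) y (pure_tensor R M M x z)"
proof -
  note m = module_axioms and T2 = tensor2_module
  \<comment> \<open>\<open>tau_id\<close> is built with the constant \<open>id\<close>, whereas
    \<open>module_hom_id\<close> speaks of the abstraction.\<close>
  have id: "id \<in> module_hom R M M" by (simp add: module_hom_def)
  note s = tensor_map[OF T2 m T2 m tau(1) id]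
  note a = tensor_assoc[OF m m m] and i = tensor_assoc_inv[OF m m m]
  show "tau_id R M \<in> module_hom R (tensor3 R M) (tensor3 R M)"
    unfolding tau_id_def comp_def
    by (rule module_hom_compose[OF i(1) module_hom_compose[OF s(1) a(1)]])
  show "x \<in> carrier M \<Longrightarrow> y \<in> carrier M \<Longrightarrow> z \<in> carrier M \<Longrightarrow>
      tau_id R M (pure_tensor R M (tensor2 R M) x (pure_tensor R M M y z))
        = pure_tensor R M (tensor2 R M) y (pure_tensor R M M x z)"
    by (simp add: tau_id_def i(2) s(2) tau(2) a(2) pure2_closed)
qed

lemmas tau_closed = module_hom_mem[OF tau(1)]
  and xi_closed = module_hom_mem[OF xi(1)]
  and tau_id_closed = module_hom_mem[OF tau_id(1)]

lemma xi_xi_xi: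
  assumes "s \<in> carrier (tensor3 R M)"
  shows "xi R M (xi R M (xi R M s)) = s"
  by (rule tensor3_hom_eqI[OF tensor3_module module_hom_compose[OF xi(1)
        module_hom_compose[OF xi(1) xi(1)]] module_hom_id _ assms]) (simp add: xi(2))

text \<open>Both composites exchange the last two factors. Since \<open>xi\<close> has order three,
  this is the dihedral relation in which a transposition inverts a rotation; it moves powers of
  \<open>xi\<close> out of \<open>tau_id\<close>.\<close>

lemma tau_id_xi_xi:
  assumes "s \<in> carrier (tensor3 R M)"
  shows "tau_id R M (xi R M (xi R M s)) = xi R M (tau_id R M s)"
  by (rule tensor3_hom_eqI[OF tensor3_module module_hom_compose[OF xi(1)
        module_hom_compose[OF xi(1) tau_id(1)]] module_hom_compose[OF tau_id(1) xi(1)] _ assms])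
    (simp add: xi(2) tau_id(2))

text \<open>This identifies \<open>xi\<close> after \<open>tau_id\<close> with the swap of the last
  two factors. The second leg \<open>t\<close> is arbitrary because it will be a value of a
  comultiplication, which need not be a pure tensor.\<close>

lemma xi_tau_id_pure:
  assumes x: "x \<in> carrier M" and t: "t \<in> carrier (tensor2 R M)"
  shows "xi R M (tau_id R M (pure_tensor R M (tensor2 R M) x t))
    = pure_tensor R M (tensor2 R M) x (tau R M t)"
proof (rule tensor_hom_eqI[OF module_axioms module_axioms tensor3_module _ _ _ t])
  note p = pure_tensor_hom_right[OF module_axioms tensor2_module _ x]
  show "(\<lambda>t. xi R M (tau_id R M (pure_tensor R M (tensor2 R M) x t)))
      \<in> module_hom R (tensor2 R M) (tensor3 R M)"
    by (rule module_hom_compose[OF p[OF module_hom_id] module_hom_compose[OF tau_id(1) xi(1)]])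
  show "(\<lambda>t. pure_tensor R M (tensor2 R M) x (tau R M t))
      \<in> module_hom R (tensor2 R M) (tensor3 R M)"
    by (rule p[OF tau(1)])
qed (use x in \<open>simp add: xi(2) tau_id(2) tau(2)\<close>)

text \<open>Two cyclic shifts bring the last factor to the front and keep the order of the other
  two, so they carry the leg \<open>t\<close> along unbroken.\<close>

lemma xi_xi_assoc_pure:
  assumes z: "z \<in> carrier M" and t: "t \<in> carrier (tensor2 R M)"
  shows "xi R M (xi R M (tensor_assoc R M M M (pure_tensor R (tensor2 R M) M t z)))
    = pure_tensor R M (tensor2 R M) z t"
proof (rule tensor_hom_eqI[OF module_axioms module_axioms tensor3_module _ _ _ t])
  note m = module_axioms and T2 = tensor2_module
  note a = tensor_assoc[OF m m m]
  show "(\<lambda>t. xi R M (xi R M (tensor_assoc R M M M (pure_tensor R (tensor2 R M) M t z))))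
      \<in> module_hom R (tensor2 R M) (tensor3 R M)"
    by (rule module_hom_compose[OF pure_tensor_hom_left[OF T2 m module_hom_id z]
          module_hom_compose[OF a(1) module_hom_compose[OF xi(1) xi(1)]]])
  show "(\<lambda>t. pure_tensor R M (tensor2 R M) z t) \<in> module_hom R (tensor2 R M) (tensor3 R M)"
    by (rule pure_tensor_hom_right[OF m T2 module_hom_id z])
  show "xi R M (xi R M (tensor_assoc R M M M
      (pure_tensor R (tensor2 R M) M (pure_tensor R M M x y) z)))
    = pure_tensor R M (tensor2 R M) z (pure_tensor R M M x y)"
    if "x \<in> carrier M" "y \<in> carrier M" for x y
    using that z by (simp add: a(2) xi(2))
qed

lemma tensor_right:
  assumes "f \<in> module_hom R M M" "g \<in> module_hom R M (tensor2 R M)"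
  shows "tensor_right R M f g \<in> module_hom R (tensor2 R M) (tensor3 R M)"
    and "x \<in> carrier M \<Longrightarrow> y \<in> carrier M \<Longrightarrow>
      tensor_right R M f g (pure_tensor R M M x y) = pure_tensor R M (tensor2 R M) (f x) (g y)"
  using tensor_map[OF module_axioms module_axioms module_axioms tensor2_module assms]
  by (simp_all add: tensor_right_def)

lemma tensor_left:
  assumes "f \<in> module_hom R M M" "g \<in> module_hom R M (tensor2 R M)"
  shows "tensor_left R M g f \<in> module_hom R (tensor2 R M) (tensor3 R M)"
    and "x \<in> carrier M \<Longrightarrow> y \<in> carrier M \<Longrightarrow>
      tensor_left R M g f (pure_tensor R M M x y)
        = tensor_assoc R M M M (pure_tensor R (tensor2 R M) M (g x) (f y))"
  using tensor_map[OF module_axioms module_axioms tensor2_module module_axioms assms(2,1)]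
    tensor_assoc(1)[OF module_axioms module_axioms module_axioms]
  by (auto simp: tensor_left_def comp_def intro: module_hom_compose)

text \<open>On a pure tensor of \<open>x\<close> and \<open>y\<close> both sides place
  \<open>f y\<close> in front of \<open>g x\<close>: the left side by swapping before the maps are
  applied, the right side by rotating afterwards.\<close>

lemma tensor_right_tau:
  assumes f: "f \<in> module_hom R M M" and g: "g \<in> module_hom R M (tensor2 R M)"
    and u: "u \<in> carrier (tensor2 R M)"
  shows "tensor_right R M f g (tau R M u) = xi R M (xi R M (tensor_left R M g f u))"
  by (rule tensor_hom_eqI[OF module_axioms module_axioms tensor3_module
        module_hom_compose[OF tau(1) tensor_right(1)[OF f g]]
        module_hom_compose[OF tensor_left(1)[OF f g] module_hom_compose[OF xi(1) xi(1)]] _ u])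
    (simp add: tau(2) tensor_right(2)[OF f g] tensor_left(2)[OF f g] xi_xi_assoc_pure
      module_hom_mem[OF f] module_hom_mem[OF g])

text \<open>A pure tensor is linear in its second leg, and \<open>tau\<close> on that leg is
  \<open>xi\<close> after \<open>tau_id\<close>. The formula for \<open>k\<close> is asked only on
  the carrier, since the axioms of a coalgebra give it only there.\<close>

lemma tensor_right_commutator:
  assumes f: "f \<in> module_hom R M M"
    and g: "g \<in> module_hom R M (tensor2 R M)" and h: "h \<in> module_hom R M (tensor2 R M)"
    and k: "k \<in> module_hom R M (tensor2 R M)"
    and eq: "\<And>x. x \<in> carrier M \<Longrightarrow>
      k x = g x \<ominus>\<^bsub>tensor2 R M\<^esub> tau R M (g x) \<oplus>\<^bsub>tensor2 R M\<^esub> h x"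
    and u: "u \<in> carrier (tensor2 R M)"
  shows "tensor_right R M f k u
    = tensor_right R M f g u \<ominus>\<^bsub>tensor3 R M\<^esub> xi R M (tau_id R M (tensor_right R M f g u))
        \<oplus>\<^bsub>tensor3 R M\<^esub> tensor_right R M f h u"
proof (rule tensor_hom_eqI[OF module_axioms module_axioms tensor3_module _ _ _ u])
  interpret T2: module R "tensor2 R M" by (rule tensor2_module)
  note r = tensor_right[OF f]
  show "tensor_right R M f k \<in> module_hom R (tensor2 R M) (tensor3 R M)"
    by (rule r(1)[OF k])
  show "(\<lambda>u. tensor_right R M f g u
      \<ominus>\<^bsub>tensor3 R M\<^esub> xi R M (tau_id R M (tensor_right R M f g u))
        \<oplus>\<^bsub>tensor3 R M\<^esub> tensor_right R M f h u) \<in> module_hom R (tensor2 R M) (tensor3 R M)"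
    by (intro module_hom_plus[OF tensor3_module] module_hom_diff[OF tensor3_module] r(1)[OF g]
        r(1)[OF h] module_hom_compose[OF r(1)[OF g] module_hom_compose[OF tau_id(1) xi(1)]])
  fix x y assume x: "x \<in> carrier M" and y: "y \<in> carrier M"
  have c: "g y \<in> carrier (tensor2 R M)" "h y \<in> carrier (tensor2 R M)" "f x \<in> carrier M"
    using x y f g h by (auto intro: module_hom_mem)
  \<comment> \<open>Tensoring with the fixed first leg \<open>f x\<close> is made a linear map so
    that simplification distributes it over the three summands of \<open>k y\<close>.\<close>
  interpret p: mod_hom R "tensor2 R M" "tensor3 R M" "pure_tensor R M (tensor2 R M) (f x)"
    by (intro mod_homI tensor2_module tensor3_module)
      (rule pure_tensor_hom_right[OF module_axioms tensor2_module module_hom_id c(3)])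
  show "tensor_right R M f k (pure_tensor R M M x y)
    = tensor_right R M f g (pure_tensor R M M x y)
      \<ominus>\<^bsub>tensor3 R M\<^esub> xi R M (tau_id R M (tensor_right R M f g (pure_tensor R M M x y)))
        \<oplus>\<^bsub>tensor3 R M\<^esub> tensor_right R M f h (pure_tensor R M M x y)"
    using x y c tau_closed[OF c(1)]
    by (simp add: r(2)[OF k] r(2)[OF g] r(2)[OF h] eq xi_tau_id_pure)
qed

end

section \<open>The Hom-co-Jacobi identity for the commutator of the modified
  comultiplication\<close>

theorem proposition4p10:
  fixes K (structure) and C (structure)
  assumes "post_hom_lie_coalgebra K C \<Delta> \<gamma> \<alpha>"
    and char_0: "\<And>n :: nat. n > 0 \<Longrightarrow> [n] \<cdot>\<^bsub>K\<^esub> \<one>\<^bsub>K\<^esub> \<noteq> \<zero>\<^bsub>K\<^esub>"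
  shows "admissible_hom_lie_coalgebra K C
    (\<lambda>x. \<Delta> x \<oplus>\<^bsub>tensor K C C\<^esub> inv\<^bsub>K\<^esub> (\<one>\<^bsub>K\<^esub> \<oplus>\<^bsub>K\<^esub> \<one>\<^bsub>K\<^esub>) \<odot>\<^bsub>tensor K C C\<^esub> \<gamma> x) \<alpha>"
proof -
  interpret post_hom_lie_coalgebra K C \<Delta> \<gamma> \<alpha> by fact
  interpret T2: module K "tensor2 K C" by (rule tensor2_module)
  interpret T3: module K "tensor3 K C" by (rule tensor3_module)
  interpret tau: mod_hom K "tensor2 K C" "tensor2 K C" "tau K C"
    by (rule mod_homI[OF T2.module_axioms T2.module_axioms tau(1)])
  define \<delta> where "\<delta> x = \<Delta> x \<oplus>\<^bsub>tensor2 K C\<^esub> inv (\<one> \<oplus> \<one>) \<odot>\<^bsub>tensor2 K C\<^esub> \<gamma> x" for x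
  define \<kappa> where "\<kappa> x = \<delta> x \<ominus>\<^bsub>tensor2 K C\<^esub> tau K C (\<delta> x)" for x
  note D = \<Delta>_linear and G = \<gamma>_linear and A = \<alpha>_linear
  note Dc = module_hom_mem[OF D] and Gc = module_hom_mem[OF G]
  \<comment> \<open>Characteristic 0 at \<open>n = 2\<close> makes 2 invertible; distributivity then
    shows that its inverse is a half, that is, two copies of it add up to 1.\<close>
  have "\<one> \<oplus> \<one> \<noteq> \<zero>" using char_0[of 2] by (simp add: numeral_2_eq_2)
  then have inv: "inv (\<one> \<oplus> \<one>) \<in> carrier K" "inv (\<one> \<oplus> \<one>) \<oplus> inv (\<one> \<oplus> \<one>) = \<one>"
    using R.Units_r_inv[of "\<one> \<oplus> \<one>"] R.l_distr[of \<one> \<one> "inv (\<one> \<oplus> \<one>)"]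
    by (auto simp: field_Units)
  have \<delta>: "\<delta> \<in> module_hom K C (tensor2 K C)"
    unfolding \<delta>_def
    by (intro module_hom_plus[OF T2.module_axioms D]
        module_hom_scale[OF T2.module_axioms inv(1) G])
  have \<kappa>: "\<kappa> \<in> module_hom K C (tensor2 K C)"
    unfolding \<kappa>_def
    by (intro module_hom_diff[OF T2.module_axioms] module_hom_compose[OF _ tau(1)] \<delta>)
  \<comment> \<open>Half of \<gamma> is still skew, so subtracting its swap doubles it and restores
    \<gamma> itself.\<close>
  have \<kappa>_eq: "\<kappa> x = \<Delta> x \<ominus>\<^bsub>tensor2 K C\<^esub> tau K C (\<Delta> x) \<oplus>\<^bsub>tensor2 K C\<^esub> \<gamma> x"
    if x: "x \<in> carrier C" for x
  proof -
    let ?h = "inv (\<one> \<oplus> \<one>) \<odot>\<^bsub>tensor2 K C\<^esub> \<gamma> x"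
    have h: "?h \<in> carrier (tensor2 K C)" using inv(1) Gc[OF x] by simp
    have "tau K C ?h = inv (\<one> \<oplus> \<one>) \<odot>\<^bsub>tensor2 K C\<^esub> tau K C (\<gamma> x)"
      using inv(1) Gc[OF x] by simp
    also have "tau K C (\<gamma> x) = \<ominus>\<^bsub>tensor2 K C\<^esub> \<gamma> x"
      using skew[OF x] tau_closed[OF Gc[OF x]] by (metis T2.M.minus_minus)
    finally have th: "tau K C ?h = \<ominus>\<^bsub>tensor2 K C\<^esub> ?h"
      using inv(1) Gc[OF x] by (simp add: T2.smult_r_minus)
    have "?h \<oplus>\<^bsub>tensor2 K C\<^esub> ?h = \<gamma> x"
      using T2.smult_l_distr[OF inv(1) inv(1) Gc[OF x]] inv(2) Gc[OF x] by simp
    moreover have "\<kappa> x = \<Delta> x \<ominus>\<^bsub>tensor2 K C\<^esub> tau K C (\<Delta> x)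
        \<oplus>\<^bsub>tensor2 K C\<^esub> (?h \<oplus>\<^bsub>tensor2 K C\<^esub> ?h)"
      using h Dc[OF x] tau_closed[OF Dc[OF x]]
      by (simp add: \<kappa>_def \<delta>_def th a_minus_def T2.M.minus_add T2.M.a_ac)
    ultimately show ?thesis by simp
  qed
  define N where "N s = s \<oplus>\<^bsub>tensor3 K C\<^esub> xi K C s \<oplus>\<^bsub>tensor3 K C\<^esub> xi K C (xi K C s)" for s
  have "N \<in> module_hom K (tensor3 K C) (tensor3 K C)"
    unfolding N_def
    by (intro module_hom_plus[OF T3.module_axioms] module_hom_id xi(1)
        module_hom_compose[OF xi(1) xi(1)])
  then interpret N: mod_hom K "tensor3 K C" "tensor3 K C" N
    by (rule mod_homI[OF T3.module_axioms T3.module_axioms])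
  \<comment> \<open>As \<open>xi\<close> has order three, applying it first only permutes the three
    summands of \<open>N\<close>.\<close>
  have N_xi: "N (xi K C s) = N s" if "s \<in> carrier (tensor3 K C)" for s
    using that by (simp add: N_def xi_xi_xi xi_closed T3.M.a_ac)
  note Nc = module_hom_mem[OF N.f_hom]
  note r = tensor_right[OF A] and l = tensor_left[OF A]
  note rc = module_hom_mem[OF r(1)] and lc = module_hom_mem[OF l(1)]
  note cl = Nc xi_closed tau_closed tau_id_closed rc[OF D] rc[OF G] rc[OF \<kappa>] lc[OF D] lc[OF G]
  let ?R = "\<lambda>f. tensor_right K C \<alpha> f" and ?L = "\<lambda>f. tensor_left K C f \<alpha>"
  let ?s = "tau_id K C"
  \<comment> \<open>The shift that \<open>tensor_right_commutator\<close> puts in front of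
    \<open>tau_id\<close> is absorbed by \<open>N\<close>.\<close>
  have NR: "N (?R \<kappa> u) = N (?R \<Delta> u) \<ominus>\<^bsub>tensor3 K C\<^esub> N (?s (?R \<Delta> u))
      \<oplus>\<^bsub>tensor3 K C\<^esub> N (?R \<gamma> u)" if u: "u \<in> carrier (tensor2 K C)" for u
    by (simp add: tensor_right_commutator[OF A D G \<kappa> \<kappa>_eq u] N_xi cl u)
  have "N (?R \<kappa> (\<kappa> x)) = \<zero>\<^bsub>tensor3 K C\<^esub>" if x: "x \<in> carrier C" for x
  proof -
    note d = Dc[OF x] and g = Gc[OF x]
    interpret RK: mod_hom K "tensor2 K C" "tensor3 K C" "?R \<kappa>"
      by (rule mod_homI[OF T2.module_axioms T3.module_axioms r(1)[OF \<kappa>]])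
    interpret RD: mod_hom K "tensor2 K C" "tensor3 K C" "?R \<Delta>"
      by (rule mod_homI[OF T2.module_axioms T3.module_axioms r(1)[OF D]])
    have co: "N (?L \<Delta> (\<Delta> x)) \<ominus>\<^bsub>tensor3 K C\<^esub> N (?R \<Delta> (\<Delta> x))
        \<ominus>\<^bsub>tensor3 K C\<^esub> N (?s (?L \<Delta> (\<Delta> x))) \<oplus>\<^bsub>tensor3 K C\<^esub> N (?s (?R \<Delta> (\<Delta> x)))
        \<oplus>\<^bsub>tensor3 K C\<^esub> N (?L \<gamma> (\<Delta> x)) = \<zero>\<^bsub>tensor3 K C\<^esub>"
      using arg_cong[OF coassociator[OF x], of N] by (simp add: cl d)
    \<comment> \<open>Skewness replaces \<gamma> by minus its swap, and
      \<open>tensor_right_tau\<close> trades the swap for a left tensor and two shifts, which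
      \<open>N\<close> removes in the next step.\<close>
    have "?R \<Delta> (\<gamma> x) = \<ominus>\<^bsub>tensor3 K C\<^esub> xi K C (xi K C (?L \<Delta> (\<gamma> x)))"
      using arg_cong[OF skew[OF x], of "?R \<Delta>"] g
      by (simp add: tau_closed tensor_right_tau[OF A D])
    then have LD: "N (?L \<Delta> (\<gamma> x)) = \<ominus>\<^bsub>tensor3 K C\<^esub> N (?R \<Delta> (\<gamma> x))"
      by (simp add: cl g N_xi)
    have "N (?R \<gamma> (\<Delta> x)) \<ominus>\<^bsub>tensor3 K C\<^esub> N (?L \<Delta> (\<gamma> x))
        \<ominus>\<^bsub>tensor3 K C\<^esub> N (?s (?R \<Delta> (\<gamma> x))) = \<zero>\<^bsub>tensor3 K C\<^esub>"
      using arg_cong[OF coderivation[OF x], of N] by (simp add: cl d g)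
    then have cd: "N (?R \<gamma> (\<Delta> x)) \<oplus>\<^bsub>tensor3 K C\<^esub> N (?R \<Delta> (\<gamma> x))
        \<ominus>\<^bsub>tensor3 K C\<^esub> N (?s (?R \<Delta> (\<gamma> x))) = \<zero>\<^bsub>tensor3 K C\<^esub>"
      by (simp add: LD a_minus_def cl g)
    have cj: "N (?R \<gamma> (\<gamma> x)) = \<zero>\<^bsub>tensor3 K C\<^esub>"
      using co_jacobi x by (simp add: hom_co_jacobi_def N_def Let_def)
    \<comment> \<open>Only the argument \<kappa> \<open>x\<close> is expanded here; the \<kappa>
      inside \<open>?R\<close> is left to \<open>NR\<close>.\<close>
    have "N (?R \<kappa> (\<kappa> x)) = N (?R \<kappa> (\<Delta> x)) \<ominus>\<^bsub>tensor3 K C\<^esub> N (?R \<kappa> (tau K C (\<Delta> x)))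
        \<oplus>\<^bsub>tensor3 K C\<^esub> N (?R \<kappa> (\<gamma> x))"
      by (simp add: \<kappa>_eq[OF x] d g cl)
    \<comment> \<open>\<open>NR\<close> is applied to each of the three arguments. In the middle
      bracket the argument is a swap, so right tensors become left ones; the two shifts inside
      \<open>?s\<close> turn into one shift outside it by \<open>tau_id_xi_xi\<close> before
      \<open>N\<close> absorbs it.\<close>
    also have "\<dots> =
        (N (?R \<Delta> (\<Delta> x)) \<ominus>\<^bsub>tensor3 K C\<^esub> N (?s (?R \<Delta> (\<Delta> x))) \<oplus>\<^bsub>tensor3 K C\<^esub> N (?R \<gamma> (\<Delta> x)))
        \<ominus>\<^bsub>tensor3 K C\<^esub> (N (?L \<Delta> (\<Delta> x)) \<ominus>\<^bsub>tensor3 K C\<^esub> N (?s (?L \<Delta> (\<Delta> x)))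
          \<oplus>\<^bsub>tensor3 K C\<^esub> N (?L \<gamma> (\<Delta> x)))
        \<oplus>\<^bsub>tensor3 K C\<^esub> (N (?R \<Delta> (\<gamma> x)) \<ominus>\<^bsub>tensor3 K C\<^esub> N (?s (?R \<Delta> (\<gamma> x)))
          \<oplus>\<^bsub>tensor3 K C\<^esub> N (?R \<gamma> (\<gamma> x)))"
      by (simp add: NR d g cl tensor_right_tau[OF A D] tensor_right_tau[OF A G] tau_id_xi_xi N_xi)
    \<comment> \<open>Regrouping the nine terms: five form minus the left side of \<open>co\<close>,
      three the left side of \<open>cd\<close>, and the last is that of \<open>cj\<close>.\<close>
    also have "\<dots> = \<ominus>\<^bsub>tensor3 K C\<^esub> (N (?L \<Delta> (\<Delta> x)) \<ominus>\<^bsub>tensor3 K C\<^esub> N (?R \<Delta> (\<Delta> x))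
        \<ominus>\<^bsub>tensor3 K C\<^esub> N (?s (?L \<Delta> (\<Delta> x))) \<oplus>\<^bsub>tensor3 K C\<^esub> N (?s (?R \<Delta> (\<Delta> x)))
        \<oplus>\<^bsub>tensor3 K C\<^esub> N (?L \<gamma> (\<Delta> x)))
      \<oplus>\<^bsub>tensor3 K C\<^esub> (N (?R \<gamma> (\<Delta> x)) \<oplus>\<^bsub>tensor3 K C\<^esub> N (?R \<Delta> (\<gamma> x))
        \<ominus>\<^bsub>tensor3 K C\<^esub> N (?s (?R \<Delta> (\<gamma> x))))
      \<oplus>\<^bsub>tensor3 K C\<^esub> N (?R \<gamma> (\<gamma> x))"
      by (simp add: a_minus_def T3.M.minus_add T3.M.a_ac cl d g)
    also have "\<dots> = \<zero>\<^bsub>tensor3 K C\<^esub>" unfolding co cd cj by simp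
    finally show ?thesis .
  qed
  then have "hom_co_jacobi K C \<alpha> \<kappa>"
    by (simp add: hom_co_jacobi_def N_def Let_def)
  then have "admissible_hom_lie_coalgebra K C \<delta> \<alpha>"
    using \<delta> A unfolding \<kappa>_def by unfold_locales
  then show ?thesis unfolding \<delta>_def .
qed

end
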